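(* Let $\Theta\subseteq\mathbb{R}^d$ be a Lipschitz submanifold (of some dimension $m<d$) which in addition is a closed subset of $\mathbb{R}^d$. Then for all $x,y\in\mathbb{R}^d$ and all $\varepsilon>0$ there exists a path $\gamma\colon[a,b]\to\mathbb{R}^d$ from $x$ to $y$ with $\ell(\gamma)<\|x-y\|+\varepsilon$ and such that $\gamma([a,b])\cap\Theta$ is finite. Therefore, $\Theta$ is finitely permeable (relative to $\mathbb{R}^d$ with the Euclidean metric) and hence permeable.
   Context: Lipschitz submanifolds: let $m,d\in\mathbb{N}\cup\{0\}$ with $m<d$. A set $\Theta\subseteq\mathbb{R}^d$ is an $m$-dimensional topological submanifold of $\mathbb{R}^d$ if for every $\xi\in\Theta$ there exist open sets $U,V\subseteq\mathbb{R}^d$ and a homeomorphism $\Psi\colon V\to U$ such that $\xi\in U$ and for all $y=(y_1,\dots,y_d)\in V$: $\Psi(y)\in\Theta\iff y_{m+1}=\dots=y_d=0$. It is called a Lipschitz submanifold if the maps $\Psi,\Psi^{-1}$ can be taken Lipschitz continuous on every compact subset of their respective domains. Let $(M,d_M)$ be a metric space (here $M=\mathbb{R}^d$ with the Euclidean metric, induced by $\|\cdot\|$). A path in $M$ is a continuous map $\gamma\colon[a,b]\to M$, from $\gamma(a)$ to $\gamma(b)$; its length is $\ell(\gamma):=\sup\{\sum_{k=1}^n d_M(\gamma(t_k),\gamma(t_{k-1})) : n\in\mathbb{N},\ a=t_0<\dots<t_n=b\}$. For $x,y\in M$, $\rho_M(x,y)$ is the infimum of $\ell(\gamma)$ over all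 paths $\gamma$ of finite length in $M$ from $x$ to $y$ ($\inf\emptyset=\infty$). For $\Theta\subseteq M$, $\rho_M^\Theta(x,y)$ (respectively $\rho_M^{\Theta,\mathrm{fin}}(x,y)$) is the same infimum restricted to those paths $\gamma\colon[a,b]\to M$ for which $\overline{\gamma([a,b])\cap\Theta}$ is at most countable (respectively $\gamma([a,b])\cap\Theta$ is finite). $\Theta$ is permeable relative to $M$ if $\rho_M=\rho_M^\Theta$, and finitely permeable relative to $M$ if $\rho_M=\rho_M^{\Theta,\mathrm{fin}}$. *)

theory Defs
  imports "HOL-Analysis.Analysis"
begin

text \<open>The coordinates of a vector in \<open>real ^ 'n\<close> are numbered by the linear order on \<open>'n\<close>:
  the index \<open>i\<close> is the coordinate with number \<open>card {..i}\<close> in \<open>{1..CARD('n)}\<close>.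
  So the plane below consists of the \<open>y\<close> with \<open>y_(m+1) = \<dots> = y_d = 0\<close>, where \<open>d = CARD('n)\<close>.\<close>

definition coordinate_plane :: "nat \<Rightarrow> (real ^ 'n::{finite,linorder}) set" where
  "coordinate_plane m = {y. \<forall>i. m < card {..i} \<longrightarrow> y $ i = 0}"

definition lipschitz_on_compacts ::
    "'a::metric_space set \<Rightarrow> ('a \<Rightarrow> 'b::metric_space) \<Rightarrow> bool" where
  "lipschitz_on_compacts S f \<longleftrightarrow> (\<forall>K. compact K \<and> K \<subseteq> S \<longrightarrow> (\<exists>L. L-lipschitz_on K f))"

definition submanifold_chart ::
    "nat \<Rightarrow> (real ^ 'n::{finite,linorder}) set \<Rightarrow>
     (real ^ 'n::{finite,linorder}) set \<Rightarrow> (real ^ 'n::{finite,linorder}) set \<Rightarrow>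
     (real ^ 'n::{finite,linorder} \<Rightarrow> real ^ 'n::{finite,linorder}) \<Rightarrow>
     (real ^ 'n::{finite,linorder} \<Rightarrow> real ^ 'n::{finite,linorder}) \<Rightarrow> bool" where
  "submanifold_chart m \<Theta> U V \<Psi> \<Phi> \<longleftrightarrow>
     open U \<and> open V \<and> homeomorphism V U \<Psi> \<Phi> \<and>
     (\<forall>y\<in>V. \<Psi> y \<in> \<Theta> \<longleftrightarrow> y \<in> coordinate_plane m)"

definition lipschitz_submanifold :: "nat \<Rightarrow> (real ^ 'n::{finite,linorder}) set \<Rightarrow> bool" where
  "lipschitz_submanifold m \<Theta> \<longleftrightarrow>
     m < CARD('n) \<and>
     (\<forall>\<xi>\<in>\<Theta>. \<exists>U V \<Psi> \<Phi>. \<xi> \<in> U \<and> submanifold_chart m \<Theta> U V \<Psi> \<Phi> \<and>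
        lipschitz_on_compacts V \<Psi> \<and> lipschitz_on_compacts U \<Phi>)"

text \<open>A path is a function on all of \<open>real\<close> together with the endpoints of its parameter interval;
  its values outside \<open>{a..b}\<close> are irrelevant.\<close>

definition path_from_to ::
    "(real \<Rightarrow> 'a::metric_space) \<Rightarrow> real \<Rightarrow> real \<Rightarrow> 'a \<Rightarrow> 'a \<Rightarrow> bool" where
  "path_from_to \<gamma> a b x y \<longleftrightarrow> a < b \<and> continuous_on {a..b} \<gamma> \<and> \<gamma> a = x \<and> \<gamma> b = y"

definition path_length :: "(real \<Rightarrow> 'a::metric_space) \<Rightarrow> real \<Rightarrow> real \<Rightarrow> ennreal" where
  "path_length \<gamma> a b =
     Sup {ennreal (\<Sum>k=1..n. dist (\<gamma> (t k)) (\<gamma> (t (k - 1)))) | (n::nat) (t::nat \<Rightarrow> real).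
            1 \<le> n \<and> t 0 = a \<and> t n = b \<and> strict_mono_on {0..n} t}"

text \<open>The ambient space \<open>M\<close> is the whole type \<open>'a\<close>. The infimum is taken in \<open>ennreal\<close>, so it is
  \<open>\<infinity>\<close> if there is no admissible path.\<close>

definition restricted_path_dist :: "('a set \<Rightarrow> bool) \<Rightarrow> 'a::metric_space \<Rightarrow> 'a \<Rightarrow> ennreal" where
  "restricted_path_dist P x y =
     Inf {path_length \<gamma> a b | \<gamma> a b.
            path_from_to \<gamma> a b x y \<and> path_length \<gamma> a b < \<infinity> \<and> P (\<gamma> ` {a..b})}"

definition path_dist :: "'a::metric_space \<Rightarrow> 'a \<Rightarrow> ennreal" where
  "path_dist = restricted_path_dist (\<lambda>_. True)"

definition path_dist_countable :: "'a::metric_space set \<Rightarrow> 'a \<Rightarrow> 'a \<Rightarrow> ennreal" where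
  "path_dist_countable \<Theta> = restricted_path_dist (\<lambda>S. countable (closure (S \<inter> \<Theta>)))"

definition path_dist_finite :: "'a::metric_space set \<Rightarrow> 'a \<Rightarrow> 'a \<Rightarrow> ennreal" where
  "path_dist_finite \<Theta> = restricted_path_dist (\<lambda>S. finite (S \<inter> \<Theta>))"

definition permeable :: "'a::metric_space set \<Rightarrow> bool" where
  "permeable \<Theta> \<longleftrightarrow> (path_dist :: 'a \<Rightarrow> 'a \<Rightarrow> ennreal) = path_dist_countable \<Theta>"

definition finitely_permeable :: "'a::metric_space set \<Rightarrow> bool" where
  "finitely_permeable \<Theta> \<longleftrightarrow> (path_dist :: 'a \<Rightarrow> 'a \<Rightarrow> ennreal) = path_dist_finite \<Theta>"

end

theory Submission
  imports Defs
begin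

text \<open>The set \<open>\<Theta>\<close> is Lebesgue null, so by Fubini almost every translate of the segment from \<open>x\<close> to
  \<open>y\<close> meets \<open>\<Theta>\<close> in a set of linear measure zero. Near every point of space, two points
  \<open>p\<close> and \<open>q\<close> are joined by a path of length at most \<open>C |p - q|\<close> that meets \<open>\<Theta>\<close> finitely often: in a
  chart, a segment with an endpoint off the plane meets the plane at most once. Along a
  translated segment close to the original one, use such detours only on an open set of small measure
  that contains all its intersections with \<open>\<Theta>\<close>, and also to join \<open>x\<close> and \<open>y\<close> to the translated
  endpoints; the additional length is arbitrarily small.\<close>

section \<open>Paths as 1-Lipschitz functions: concatenation and images of segments\<close>

text \<open>Rectifiable paths are represented by 1-Lipschitz functions on \<open>{0..l}\<close>: these are easy to
  concatenate, and \<open>l\<close> bounds the length.\<close>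

definition reach :: "'a::metric_space set \<Rightarrow> 'a \<Rightarrow> 'a \<Rightarrow> real \<Rightarrow> bool" where
  "reach T p q l \<longleftrightarrow> 0 \<le> l \<and>
     (\<exists>\<gamma>. 1-lipschitz_on {0..l} \<gamma> \<and> \<gamma> 0 = p \<and> \<gamma> l = q \<and> finite (\<gamma> ` {0..l} \<inter> T))"

lemma reach_refl: "0 \<le> l \<Longrightarrow> reach T p p l"
  unfolding reach_def
  by (auto intro!: exI[of _ "\<lambda>_. p"] lipschitz_onI intro: finite_subset[of _ "{p}"])

lemma reach_trans:
  assumes "reach T p q l" and "reach T q r k"
  shows "reach T p r (l + k)"
proof -
  obtain f g where lk: "0 \<le> l" "0 \<le> k"
    and f: "1-lipschitz_on {0..l} f" "f 0 = p" "f l = q" "finite (f ` {0..l} \<inter> T)"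
    and g: "1-lipschitz_on {0..k} g" "g 0 = q" "g k = r" "finite (g ` {0..k} \<inter> T)"
    using assms unfolding reach_def by blast
  define h where "h = (\<lambda>t. if t \<le> l then f t else g (t - l))"
  have "1-lipschitz_on {l..l + k} (\<lambda>t. g (t - l))"
  proof (rule lipschitz_onI)
    fix x y assume "x \<in> {l..l + k}" "y \<in> {l..l + k}"
    then show "dist (g (x - l)) (g (y - l)) \<le> 1 * dist x y"
      using lipschitz_onD[OF g(1), of "x - l" "y - l"] by (simp add: dist_real_def)
  qed simp
  then have "1-lipschitz_on {0..l + k} h"
    unfolding h_def using f g by (intro lipschitz_on_concat) auto
  moreover have "h 0 = p" "h (l + k) = r"
    using f g lk by (auto simp: h_def)
  moreover have "h ` {0..l + k} \<inter> T \<subseteq> (f ` {0..l} \<inter> T) \<union> (g ` {0..k} \<inter> T)"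
    by (fastforce simp: h_def)
  then have "finite (h ` {0..l + k} \<inter> T)"
    using f g by (meson finite_UnI finite_subset)
  ultimately show ?thesis
    unfolding reach_def using lk by auto
qed

text \<open>The path rests at \<open>q\<close> for the remaining time \<open>k - l\<close>, as a
  1-Lipschitz function may.\<close>

lemma reach_mono: "reach T p q l \<Longrightarrow> l \<le> k \<Longrightarrow> reach T p q k"
  using reach_trans[OF _ reach_refl[of "k - l"]] by fastforce

text \<open>For positive \<open>l\<close> the segment is traversed at constant speed in time
  \<open>l\<close>; followed by \<open>\<Psi>\<close> this has Lipschitz constant at most
  \<open>L * dist a b / l\<close>, hence at most 1.\<close>

lemma reach_affine_lipschitz:
  fixes a b :: "'a::real_normed_vector" and \<Psi> :: "'a \<Rightarrow> 'b::metric_space"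
  assumes \<Psi>: "L-lipschitz_on (closed_segment a b) \<Psi>"
    and fin: "finite {x \<in> closed_segment a b. \<Psi> x \<in> T}"
    and l: "L * dist a b \<le> l"
  shows "reach T (\<Psi> a) (\<Psi> b) l"
proof -
  have L: "0 \<le> L" using \<Psi> lipschitz_on_nonneg by blast
  then have l0: "0 \<le> l" using l by (meson mult_nonneg_nonneg order_trans zero_le_dist)
  show ?thesis
  proof (cases "l = 0")
    \<comment> \<open>The parametrization used below divides by \<open>l\<close>. For
      \<open>l = 0\<close> the two end points of the image coincide.\<close>
    case True
    then have "dist (\<Psi> a) (\<Psi> b) \<le> 0"
      using lipschitz_onD[OF \<Psi>, of a b] l by (metis ends_in_segment order_trans)
    then show ?thesis using True reach_refl[of l T "\<Psi> b"] by simp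
  next
    case False
    then have lp: "l > 0" using l0 by simp
    define s where "s = (\<lambda>t. (1 - t / l) *\<^sub>R a + (t / l) *\<^sub>R b)"
    have seg: "s t \<in> closed_segment a b" if "t \<in> {0..l}" for t
      unfolding s_def closed_segment_def using that lp by (auto intro!: exI[of _ "t / l"])
    have dist_s: "dist (s t) (s u) = \<bar>t - u\<bar> / l * dist a b" for t u
    proof -
      have "s t - s u = ((t - u) / l) *\<^sub>R (b - a)"
        by (simp add: s_def algebra_simps diff_divide_distrib)
      then show ?thesis
        using lp by (simp add: dist_norm norm_minus_commute)
    qed
    have "1-lipschitz_on {0..l} (\<Psi> \<circ> s)"
    proof (rule lipschitz_onI)
      fix t u assume "t \<in> {0..l}" "u \<in> {0..l}"
      then have "dist (\<Psi> (s t)) (\<Psi> (s u)) \<le> L * dist (s t) (s u)"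
        using lipschitz_onD[OF \<Psi>] seg by blast
      also have "\<dots> = \<bar>t - u\<bar> / l * (L * dist a b)"
        by (simp add: dist_s)
      also have "\<dots> \<le> \<bar>t - u\<bar> / l * l"
        using l lp by (intro mult_left_mono) auto
      finally show "dist ((\<Psi> \<circ> s) t) ((\<Psi> \<circ> s) u) \<le> 1 * dist t u"
        using lp by (simp add: dist_real_def)
    qed auto
    moreover have "(\<Psi> \<circ> s) 0 = \<Psi> a" "(\<Psi> \<circ> s) l = \<Psi> b"
      using lp by (auto simp: s_def)
    moreover have "(\<Psi> \<circ> s) ` {0..l} \<inter> T \<subseteq> \<Psi> ` {x \<in> closed_segment a b. \<Psi> x \<in> T}"
      using seg by auto
    then have "finite ((\<Psi> \<circ> s) ` {0..l} \<inter> T)"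
      using fin finite_surj by blast
    ultimately show ?thesis unfolding reach_def using l0 by blast
  qed
qed

lemma reach_segment:
  fixes p q :: "'a::real_normed_vector"
  assumes "closed_segment p q \<inter> T = {}"
  shows "reach T p q (dist p q)"
proof -
  have "{x \<in> closed_segment p q. id x \<in> T} = {}" using assms by auto
  then have "reach T (id p) (id q) (dist p q)"
    by (intro reach_affine_lipschitz[of 1]) (simp_all only: lipschitz_on_def, simp_all)
  then show ?thesis by simp
qed

section \<open>Length of a path against its chord and its Lipschitz constant\<close>

text \<open>The partition without interior points contributes exactly this distance to the
  supremum.\<close>

lemma path_length_ge_dist:
  assumes "a < b"
  shows "ennreal (dist (\<gamma> a) (\<gamma> b)) \<le> path_length \<gamma> a b"
  unfolding path_length_def
proof (rule Sup_upper, rule CollectI, intro exI conjI)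
  define t where "t = (\<lambda>k::nat. if k = 0 then a else b)"
  show "t 0 = a" "t 1 = b" "(1::nat) \<le> 1"
    by (auto simp: t_def)
  show "strict_mono_on {0..1} t"
    using assms by (auto simp: strict_mono_on_def t_def)
  show "ennreal (dist (\<gamma> a) (\<gamma> b)) = ennreal (\<Sum>k=1..1. dist (\<gamma> (t k)) (\<gamma> (t (k - 1))))"
    by (simp add: t_def dist_commute)
qed

text \<open>Each chord is at most \<open>L\<close> times its parameter increment, and the increments
  telescope.\<close>

lemma path_length_lipschitz_le:
  assumes "L-lipschitz_on {a..b} \<gamma>"
  shows "path_length \<gamma> a b \<le> ennreal (L * (b - a))"
  unfolding path_length_def
proof (rule Sup_least, clarify, rule ennreal_leI)
  fix n :: nat and t :: "nat \<Rightarrow> real"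
  assume n: "1 \<le> n" and mono: "strict_mono_on {0..n} t" and ab: "a = t 0" "b = t n"
  have t_mono: "t i \<le> t j" if "i \<le> j" "j \<le> n" for i j
    using strict_mono_on_leD[OF mono] that by auto
  have "(\<Sum>k=1..n. dist (\<gamma> (t k)) (\<gamma> (t (k - 1)))) \<le> (\<Sum>k=1..n. L * (t k - t (k - 1)))"
  proof (rule sum_mono)
    fix k assume k: "k \<in> {1..n}"
    then have "t 0 \<le> t (k - 1)" "t (k - 1) \<le> t k" "t k \<le> t n"
      by (auto intro!: t_mono)
    then show "dist (\<gamma> (t k)) (\<gamma> (t (k - 1))) \<le> L * (t k - t (k - 1))"
      using lipschitz_onD[OF assms, of "t k" "t (k - 1)"] ab by (auto simp: dist_real_def)
  qed
  also have "\<dots> = L * (\<Sum>k=1..n. t k - t (k - 1))"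
    by (simp add: sum_distrib_left)
  also have "(\<Sum>k=1..n. t k - t (k - 1)) = t n - t 0"
    using sum_telescope''[of 0 n t] by (simp add: atLeastSucAtMost_greaterThanAtMost[symmetric])
  finally show "(\<Sum>k=1..n. dist (\<gamma> (t k)) (\<gamma> (t (k - 1)))) \<le> L * (t n - t 0)" .
qed

lemma reach_imp_path:
  assumes "reach T p q l" and "l < k"
  obtains \<gamma> a b where "path_from_to \<gamma> a b p q" and "path_length \<gamma> a b < ennreal k"
    and "finite (\<gamma> ` {a..b} \<inter> T)"
proof -
  \<comment> \<open>A duration below \<open>k\<close> for the strict bound on the length, and
    positive even if \<open>l = 0\<close>, since a path needs a nondegenerate parameter
    interval.\<close>
  define j where "j = (l + k) / 2"
  have j: "0 < j" "j < k" and "reach T p q j"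
    using assms reach_mono[of T p q l j] by (auto simp: j_def reach_def)
  then obtain \<gamma> where \<gamma>: "1-lipschitz_on {0..j} \<gamma>" "\<gamma> 0 = p" "\<gamma> j = q" "finite (\<gamma> ` {0..j} \<inter> T)"
    unfolding reach_def by blast
  show thesis
  proof
    show "path_from_to \<gamma> 0 j p q"
      using \<gamma> j lipschitz_on_continuous_on[OF \<gamma>(1)] by (auto simp: path_from_to_def)
    show "path_length \<gamma> 0 j < ennreal k"
      using path_length_lipschitz_le[OF \<gamma>(1)] j
      by (metis diff_zero ennreal_lessI le_less_trans less_trans mult_1)
  qed (rule \<gamma>)
qed

section \<open>Affine planes, charts on balls, and nullity of submanifolds\<close>

text \<open>Two distinct common points would span a line through \<open>a\<close> inside
  \<open>S\<close>, so there is at most one.\<close>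

lemma finite_closed_segment_Int_affine:
  fixes a b :: "'a::real_vector"
  assumes S: "affine S" and a: "a \<notin> S"
  shows "finite (closed_segment a b \<inter> S)"
proof -
  have "x = y" if x: "x \<in> closed_segment a b \<inter> S" and y: "y \<in> closed_segment a b \<inter> S" for x y
  proof (rule ccontr)
    assume ne: "x \<noteq> y"
    obtain u v where x': "x = (1 - u) *\<^sub>R a + u *\<^sub>R b" and y': "y = (1 - v) *\<^sub>R a + v *\<^sub>R b"
      using x y by (auto simp: closed_segment_def)
    have uv: "v - u \<noteq> 0" using ne x' y' by auto
    \<comment> \<open>Eliminating \<open>b\<close> from the two representations makes
      \<open>a\<close> an affine combination of \<open>x\<close> and \<open>y\<close>.\<close>
    have "(v - u) *\<^sub>R a = v *\<^sub>R x - u *\<^sub>R y"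
      by (simp add: x' y' algebra_simps)
    then have "a = (1 / (v - u)) *\<^sub>R (v *\<^sub>R x - u *\<^sub>R y)"
      using uv by (metis divide_self_if scaleR_one scaleR_scaleR times_divide_eq_left mult_1)
    then have "a = (v / (v - u)) *\<^sub>R x + (- u / (v - u)) *\<^sub>R y"
      by (simp add: scaleR_diff_right)
    moreover have "v / (v - u) + - u / (v - u) = 1"
      using uv by (simp add: diff_divide_distrib[symmetric])
    ultimately show False
      using S x y a unfolding affine_def by blast
  qed
  then show ?thesis
    by (metis finite.simps is_singletonI' is_singleton_def)
qed

lemma affine_coordinate_plane: "affine (coordinate_plane m)"
  by (auto simp: affine_def coordinate_plane_def)

lemma negligible_coordinate_plane:
  assumes "m < CARD('n)"
  shows "negligible (coordinate_plane m :: (real ^ 'n::{finite,linorder}) set)"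
proof -
  \<comment> \<open>The greatest index has number \<open>CARD('n)\<close>, which exceeds
    \<open>m\<close>, so this coordinate vanishes on the whole plane.\<close>
  define i :: "'n::{finite,linorder}" where "i = Max UNIV"
  have "{..i} = UNIV" by (auto simp: i_def)
  then have "coordinate_plane m \<subseteq> {y :: real ^ 'n::{finite,linorder}. y $ i = 0}"
    using assms by (auto simp: coordinate_plane_def)
  moreover have "negligible {y :: real ^ 'n::{finite,linorder}. y $ i = 0}"
    by (rule negligible_standard_hyperplane_cart)
  ultimately show ?thesis by (rule negligible_subset[rotated])
qed

text \<open>Shrinking a chart to closed balls, which are compact, yields single constants
  \<open>K\<close> and \<open>L\<close>. The ball around \<open>\<eta>\<close> is convex, so it
  contains the segments that are later mapped back by \<open>\<Psi>\<close>.\<close>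

lemma lipschitz_submanifold_local_chart:
  fixes \<Theta> :: "(real ^ 'n::{finite,linorder}) set"
  assumes "lipschitz_submanifold m \<Theta>" and "\<xi> \<in> \<Theta>"
  obtains s and \<Phi> :: "real ^ 'n::{finite,linorder} \<Rightarrow> real ^ 'n::{finite,linorder}" and \<eta> r K \<Psi> L
  where "s > 0" "\<Phi> ` cball \<xi> s \<subseteq> cball \<eta> r"
    "K-lipschitz_on (cball \<eta> r) \<Psi>" "L-lipschitz_on (cball \<xi> s) \<Phi>"
    "\<forall>x\<in>cball \<xi> s. \<Psi> (\<Phi> x) = x"
    "\<forall>y\<in>cball \<eta> r. \<Psi> y \<in> \<Theta> \<longleftrightarrow> y \<in> coordinate_plane m"
proof -
  obtain U V \<Psi> \<Phi> where \<xi>: "\<xi> \<in> U" and chart: "submanifold_chart m \<Theta> U V \<Psi> \<Phi>"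
    and lip: "lipschitz_on_compacts V \<Psi>" "lipschitz_on_compacts U \<Phi>"
    using assms unfolding lipschitz_submanifold_def by blast
  have op: "open U" "open V" and hom: "homeomorphism V U \<Psi> \<Phi>"
    and iff: "\<And>y. y \<in> V \<Longrightarrow> \<Psi> y \<in> \<Theta> \<longleftrightarrow> y \<in> coordinate_plane m"
    using chart by (auto simp: submanifold_chart_def)
  have "\<Phi> \<xi> \<in> V" using hom \<xi> by (auto simp: homeomorphism_def)
  then obtain r where r: "r > 0" "cball (\<Phi> \<xi>) r \<subseteq> V"
    using op(2) open_contains_cball by blast
  \<comment> \<open>The radius \<open>s\<close> is chosen after \<open>r\<close>, so small that
    \<open>\<Phi>\<close> stays where \<open>\<Psi>\<close> is controlled.\<close>
  have "open (U \<inter> \<Phi> -` ball (\<Phi> \<xi>) r)"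
    using op hom by (intro continuous_open_preimage) (auto simp: homeomorphism_def)
  moreover have "\<xi> \<in> U \<inter> \<Phi> -` ball (\<Phi> \<xi>) r" using \<xi> r(1) by simp
  ultimately obtain s where s: "s > 0" "cball \<xi> s \<subseteq> U \<inter> \<Phi> -` ball (\<Phi> \<xi>) r"
    unfolding open_contains_cball by blast
  obtain K where K: "K-lipschitz_on (cball (\<Phi> \<xi>) r) \<Psi>"
    using lip(1) r(2) compact_cball[of "\<Phi> \<xi>" r] unfolding lipschitz_on_compacts_def by blast
  obtain L where L: "L-lipschitz_on (cball \<xi> s) \<Phi>"
    using lip(2) s(2) compact_cball[of \<xi> s] unfolding lipschitz_on_compacts_def by blast
  show thesis
  proof (rule that[OF s(1) _ K L])
    show "\<Phi> ` cball \<xi> s \<subseteq> cball (\<Phi> \<xi>) r" using s(2) by auto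
    show "\<forall>x\<in>cball \<xi> s. \<Psi> (\<Phi> x) = x"
      using s(2) hom by (auto simp: homeomorphism_def)
    show "\<forall>y\<in>cball (\<Phi> \<xi>) r. \<Psi> y \<in> \<Theta> \<longleftrightarrow> y \<in> coordinate_plane m"
      using iff r(2) by blast
  qed
qed

text \<open>Near each of its points, \<open>\<Theta>\<close> lies in the Lipschitz image of a piece
  of a null plane. Such maps of the space to itself preserve null sets, and nullity is a local
  property.\<close>

lemma negligible_lipschitz_submanifold:
  fixes \<Theta> :: "(real ^ 'n::{finite,linorder}) set"
  assumes M: "lipschitz_submanifold m \<Theta>"
  shows "negligible \<Theta>"
proof (rule locally_negligible_alt[THEN iffD2], rule ballI)
  fix \<xi> assume "\<xi> \<in> \<Theta>"
  with M obtain s \<Phi> and \<eta> :: "real ^ 'n::{finite,linorder}" and r K \<Psi> L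
    where s: "s > 0" and im: "\<Phi> ` cball \<xi> s \<subseteq> cball \<eta> r"
    and K: "K-lipschitz_on (cball \<eta> r) \<Psi>" and "L-lipschitz_on (cball \<xi> s) \<Phi>"
    and inv: "\<forall>x\<in>cball \<xi> s. \<Psi> (\<Phi> x) = x"
    and iff: "\<forall>y\<in>cball \<eta> r. \<Psi> y \<in> \<Theta> \<longleftrightarrow> y \<in> coordinate_plane m"
    by (rule lipschitz_submanifold_local_chart)
  let ?P = "cball \<eta> r \<inter> coordinate_plane m"
  have "m < CARD('n)" using M by (simp add: lipschitz_submanifold_def)
  then have "negligible ?P"
    using negligible_coordinate_plane negligible_Int by blast
  then have "negligible (\<Psi> ` ?P)"
  proof (rule negligible_locally_Lipschitz_image[rotated])
    show "\<exists>T B. open T \<and> x \<in> T \<and> (\<forall>y\<in>?P \<inter> T. norm (\<Psi> y - \<Psi> x) \<le> B * norm (y - x))"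
      if "x \<in> ?P" for x
      using lipschitz_onD[OF K] that by (intro exI[of _ UNIV] exI[of _ K]) (auto simp: dist_norm)
  qed auto
  moreover have "\<Theta> \<inter> ball \<xi> s \<subseteq> \<Psi> ` ?P"
  proof
    fix x assume x: "x \<in> \<Theta> \<inter> ball \<xi> s"
    then have "\<Psi> (\<Phi> x) = x" "\<Phi> x \<in> cball \<eta> r"
      using inv im by (auto simp: image_subset_iff)
    then show "x \<in> \<Psi> ` ?P"
      using iff x by (metis IntD1 IntI imageI)
  qed
  ultimately have "negligible (\<Theta> \<inter> ball \<xi> s)"
    using negligible_subset by blast
  then show "\<exists>U. openin (top_of_set \<Theta>) U \<and> \<xi> \<in> U \<and> negligible U"
    using s \<open>\<xi> \<in> \<Theta>\<close> by (intro exI[of _ "\<Theta> \<inter> ball \<xi> s"]) auto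
qed

section \<open>Detours of length proportional to the distance\<close>

text \<open>One constant serves all pairs near \<open>\<xi>\<close> and the bound is linear, so a
  detour around a short piece of a segment costs a fixed multiple of the length of that
  piece.\<close>

definition locally_reachable :: "'a::metric_space set \<Rightarrow> real \<Rightarrow> 'a \<Rightarrow> bool" where
  "locally_reachable T C \<xi> \<longleftrightarrow>
     (\<exists>r>0. \<forall>p\<in>ball \<xi> r. \<forall>q\<in>ball \<xi> r. reach T p q (C * dist p q))"

lemma locally_reachable_mono:
  "locally_reachable T C \<xi> \<Longrightarrow> C \<le> D \<Longrightarrow> locally_reachable T D \<xi>"
  unfolding locally_reachable_def by (meson mult_right_mono reach_mono zero_le_dist)

text \<open>A ball inside the one for \<open>\<xi>\<close> inherits its paths. Openness makes the
  constant persist near a parameter, as bisection along a segment demands.\<close>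

lemma open_locally_reachable: "open {\<xi>. locally_reachable T C \<xi>}"
  unfolding open_contains_ball
proof (intro ballI)
  fix \<xi> assume "\<xi> \<in> {\<xi>. locally_reachable T C \<xi>}"
  then obtain r where r: "r > 0" "\<And>p q. p \<in> ball \<xi> r \<Longrightarrow> q \<in> ball \<xi> r \<Longrightarrow> reach T p q (C * dist p q)"
    unfolding locally_reachable_def by auto
  have "ball \<xi> r \<subseteq> {\<xi>. locally_reachable T C \<xi>}"
  proof
    fix x assume "x \<in> ball \<xi> r"
    then obtain s where "s > 0" "ball x s \<subseteq> ball \<xi> r"
      using open_ball[of \<xi> r] unfolding open_contains_ball by blast
    then show "x \<in> {\<xi>. locally_reachable T C \<xi>}"
      unfolding locally_reachable_def using r(2) by blast
  qed
  then show "\<exists>e>0. ball \<xi> e \<subseteq> {\<xi>. locally_reachable T C \<xi>}"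
    using r(1) by blast
qed

text \<open>Balls are convex, so the segment itself avoids \<open>T\<close>. The constant 1 matters:
  away from \<open>T\<close> no length is added.\<close>

lemma locally_reachable_outside:
  fixes T :: "'a::real_normed_vector set"
  assumes "closed T" and "\<xi> \<notin> T"
  shows "locally_reachable T 1 \<xi>"
proof -
  have "open (- T)" using assms by auto
  then obtain r where "r > 0" and r: "ball \<xi> r \<subseteq> - T"
    using assms unfolding open_contains_ball by blast
  have "reach T p q (1 * dist p q)" if "p \<in> ball \<xi> r" "q \<in> ball \<xi> r" for p q
  proof -
    have "closed_segment p q \<subseteq> ball \<xi> r"
      using that by (intro closed_segment_subset) auto
    then show ?thesis using r reach_segment[of p q T] by fastforce
  qed
  then show ?thesis unfolding locally_reachable_def using \<open>r > 0\<close> by blast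
qed

text \<open>If \<open>p\<close> and \<open>q\<close> both lie in \<open>\<Theta>\<close>, the image of the segment under the chart may lie entirely
  in \<open>\<Theta>\<close>; the path then goes through a nearby third point outside \<open>\<Theta>\<close>.\<close>

lemma locally_reachable_submanifold:
  fixes \<Theta> :: "(real ^ 'n::{finite,linorder}) set"
  assumes M: "lipschitz_submanifold m \<Theta>" and "\<xi> \<in> \<Theta>"
  shows "\<exists>C. locally_reachable \<Theta> C \<xi>"
proof -
  from assms obtain s \<Phi> and \<eta> :: "real ^ 'n::{finite,linorder}" and r K \<Psi> L
    where s: "s > 0" and im: "\<Phi> ` cball \<xi> s \<subseteq> cball \<eta> r"
    and K: "K-lipschitz_on (cball \<eta> r) \<Psi>" and L: "L-lipschitz_on (cball \<xi> s) \<Phi>"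
    and inv: "\<forall>x\<in>cball \<xi> s. \<Psi> (\<Phi> x) = x"
    and iff: "\<forall>y\<in>cball \<eta> r. \<Psi> y \<in> \<Theta> \<longleftrightarrow> y \<in> coordinate_plane m"
    by (rule lipschitz_submanifold_local_chart)
  have K0: "0 \<le> K" and L0: "0 \<le> L" using K L lipschitz_on_nonneg by blast+
  \<comment> \<open>Passing into the chart and back costs the factor \<open>K * L\<close>.\<close>
  have outside: "reach \<Theta> p q (K * L * dist p q)"
    if p: "p \<in> cball \<xi> s" and q: "q \<in> cball \<xi> s" and off: "p \<notin> \<Theta> \<or> q \<notin> \<Theta>" for p q
  proof -
    have \<Phi>: "\<Phi> p \<in> cball \<eta> r" "\<Phi> q \<in> cball \<eta> r" using im p q by blast+
    then have seg: "closed_segment (\<Phi> p) (\<Phi> q) \<subseteq> cball \<eta> r"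
      by (intro closed_segment_subset) auto
    have "\<Phi> p \<notin> coordinate_plane m \<or> \<Phi> q \<notin> coordinate_plane m"
      using off bspec[OF iff \<Phi>(1)] bspec[OF iff \<Phi>(2)] inv p q by auto
    then have "finite (closed_segment (\<Phi> p) (\<Phi> q) \<inter> coordinate_plane m)"
      using finite_closed_segment_Int_affine[OF affine_coordinate_plane]
      by (metis closed_segment_commute)
    moreover have "{x \<in> closed_segment (\<Phi> p) (\<Phi> q). \<Psi> x \<in> \<Theta>} =
        closed_segment (\<Phi> p) (\<Phi> q) \<inter> coordinate_plane m"
      using seg iff by auto
    moreover have "K * dist (\<Phi> p) (\<Phi> q) \<le> K * L * dist p q"
      using lipschitz_onD[OF L p q] K0 by (simp add: mult.assoc mult_left_mono)
    ultimately have "reach \<Theta> (\<Psi> (\<Phi> p)) (\<Psi> (\<Phi> q)) (K * L * dist p q)"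
      using lipschitz_on_subset[OF K seg] by (intro reach_affine_lipschitz) auto
    then show ?thesis using inv p q by simp
  qed
  \<comment> \<open>The factor 3 bounds the way through a point \<open>z\<close> with
    \<open>dist p z < dist p q\<close>. The radius \<open>s / 3\<close> gives
    \<open>dist p q < 2 * (s / 3)\<close>, which keeps \<open>z\<close> in the ball of radius
    \<open>s\<close>.\<close>
  have "reach \<Theta> p q (3 * (K * L) * dist p q)"
    if p: "p \<in> ball \<xi> (s / 3)" and q: "q \<in> ball \<xi> (s / 3)" for p q
  proof (cases "p = q")
    case True then show ?thesis by (simp add: reach_refl)
  next
    case False
    \<comment> \<open>A null set contains no nonempty ball.\<close>
    then have "\<not> ball p (dist p q) \<subseteq> \<Theta>"
      using negligible_lipschitz_submanifold[OF M] negligible_subset open_not_negligible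
      by (metis ball_eq_empty not_le open_ball zero_less_dist_iff)
    then obtain z where z: "dist p z < dist p q" "z \<notin> \<Theta>"
      unfolding subset_iff mem_ball by blast
    have zq: "dist z q \<le> 2 * dist p q"
      using z dist_triangle[of z q p] by (simp add: dist_commute)
    have "dist p q < 2 * (s / 3)"
      using p q dist_triangle[of p q \<xi>] by (simp add: dist_commute)
    then have "z \<in> cball \<xi> s"
      using z p dist_triangle[of \<xi> z p] by simp
    then have "reach \<Theta> p q (K * L * dist p z + K * L * dist z q)"
      using z(2) p q s by (intro reach_trans[OF outside outside]) auto
    moreover have "K * L * (dist p z + dist z q) \<le> K * L * (3 * dist p q)"
      using z zq K0 L0 by (intro mult_left_mono) auto
    ultimately show ?thesis
      by (elim reach_mono) (simp add: algebra_simps)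
  qed
  then show ?thesis
    unfolding locally_reachable_def using s by (metis divide_pos_pos zero_less_numeral)
qed

text \<open>Compactness of \<open>{0..1}\<close> by bisection: adjacent intervals combine under the
  larger of their constants, and openness gives one constant near each parameter.\<close>

lemma locally_reachable_uniform:
  fixes T :: "'a::real_normed_vector set"
  assumes "\<And>\<xi>. \<exists>C. locally_reachable T C \<xi>"
  obtains C where "C \<ge> 0" and "\<And>t. t \<in> {0..1} \<Longrightarrow> locally_reachable T C (z + t *\<^sub>R v)"
proof -
  have "\<exists>C. \<forall>t\<in>{0..1}. locally_reachable T C (z + t *\<^sub>R v)"
    using zero_le_one
  proof (induction rule: Bolzano)
    case (trans a b c)
    then obtain C D where C: "\<forall>t\<in>{a..b}. locally_reachable T C (z + t *\<^sub>R v)"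
      and D: "\<forall>t\<in>{b..c}. locally_reachable T D (z + t *\<^sub>R v)" by auto
    have "\<forall>t\<in>{a..c}. locally_reachable T (max C D) (z + t *\<^sub>R v)"
    proof
      fix t assume "t \<in> {a..c}"
      then consider "t \<in> {a..b}" | "t \<in> {b..c}" by fastforce
      then show "locally_reachable T (max C D) (z + t *\<^sub>R v)"
        by cases (use C D locally_reachable_mono max.cobounded1 max.cobounded2 in blast)+
    qed
    then show ?case by blast
  next
    case (local x)
    obtain C where C: "locally_reachable T C (z + x *\<^sub>R v)" using assms by blast
    have "open ((\<lambda>t. z + t *\<^sub>R v) -` {\<xi>. locally_reachable T C \<xi>})"
      by (intro open_vimage open_locally_reachable continuous_intros)
    moreover have "x \<in> (\<lambda>t. z + t *\<^sub>R v) -` {\<xi>. locally_reachable T C \<xi>}" using C by simp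
    ultimately obtain d where d: "d > 0" "ball x d \<subseteq> (\<lambda>t. z + t *\<^sub>R v) -` {\<xi>. locally_reachable T C \<xi>}"
      unfolding open_contains_ball by blast
    have "\<forall>t\<in>{a..b}. locally_reachable T C (z + t *\<^sub>R v)" if "a \<le> x \<and> x \<le> b \<and> b - a < d" for a b
    proof
      fix t assume "t \<in> {a..b}"
      then have "t \<in> ball x d" using that by (auto simp: dist_real_def)
      then show "locally_reachable T C (z + t *\<^sub>R v)" using d(2) by auto
    qed
    then show ?case using d(1) by blast
  qed
  then show thesis
    using that by (meson locally_reachable_mono max.cobounded1 max.cobounded2)
qed

section \<open>Segments with a null set of intersections\<close>

text \<open>An open set \<open>W\<close> of measure less than \<open>d\<close> contains all
  parameters of intersections. Each sufficiently short interval either lies in \<open>W\<close>,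
  where a detour is used, or carries a piece of the segment that avoids \<open>T\<close>. The excess
  is at most \<open>D\<close> times the measure of \<open>W\<close>.\<close>

lemma reach_along_null_segment:
  fixes T :: "'a::real_normed_vector set"
  assumes T: "closed T" and loc: "\<And>\<xi>. \<exists>C. locally_reachable T C \<xi>"
    and null: "negligible {t. z + t *\<^sub>R v \<in> T}" and e: "e > 0"
  shows "reach T z (z + v) (norm v + e)"
proof -
  obtain C where C0: "C \<ge> 0" and C: "\<And>t. t \<in> {0..1} \<Longrightarrow> locally_reachable T C (z + t *\<^sub>R v)"
    using locally_reachable_uniform[OF loc] by blast
  define N where "N = {t. z + t *\<^sub>R v \<in> T}"
  have N: "N \<in> null_sets lebesgue"
    using null unfolding N_def negligible_iff_null_sets .
  \<comment> \<open>The length of a detour per unit of the parameter.\<close>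
  define D where "D = C * norm v"
  have D0: "D \<ge> 0" using C0 by (simp add: D_def)
  \<comment> \<open>Chosen so that \<open>D * d \<le> e\<close>; the summand 1 covers
    \<open>D = 0\<close>.\<close>
  define d where "d = e / (D + 1)"
  have d: "d > 0" using e D0 by (simp add: d_def)
  obtain W where W: "open W" "N \<subseteq> W" "emeasure lebesgue (W - N) < ennreal d"
    by (rule sets_lebesgue_outer_open[OF null_setsD2[OF N] d])
  have W': "W \<in> sets lebesgue" using W(1) by (simp add: borel_open)
  have emW: "emeasure lebesgue W < ennreal d"
    using W(3) N W' by (simp add: emeasure_Diff_null_set)
  \<comment> \<open>Half-open intervals make adjacent pieces disjoint, so \<open>\<mu>\<close> is
    additive.\<close>
  define \<mu> where "\<mu> a b = measure lebesgue (W \<inter> {a..<b})" for a b :: real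
  have meas: "W \<inter> {a..<b} \<in> lmeasurable" for a b :: real
    using W' by (intro bounded_set_imp_lmeasurable bounded_Int) auto
  have add: "\<mu> a b + \<mu> b c = \<mu> a c" if "a \<le> b" "b \<le> c" for a b c
  proof -
    have "W \<inter> {a..<c} = (W \<inter> {a..<b}) \<union> (W \<inter> {b..<c})" using that by auto
    moreover have "(W \<inter> {a..<b}) \<inter> (W \<inter> {b..<c}) = {}" by auto
    ultimately show ?thesis
      unfolding \<mu>_def by (metis meas measure_Un3 measure_empty diff_zero)
  qed
  \<comment> \<open>This bound is additive in the interval, so by bisection it only has to be checked locally: near
    parameters outside \<open>N\<close> the segment itself works, near \<open>N\<close> the detours do.\<close>
  have "reach T (z + 0 *\<^sub>R v) (z + 1 *\<^sub>R v) (norm v * (1 - 0) + D * \<mu> 0 1)"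
    using zero_le_one
  proof (induction rule: Bolzano)
    case (trans a b c)
    have "norm v * (b - a) + D * \<mu> a b + (norm v * (c - b) + D * \<mu> b c) =
        norm v * (c - a) + D * \<mu> a c"
      using add[OF trans(3,4)] by (auto simp: algebra_simps simp flip: add[OF trans(3,4)])
    then show ?case using reach_trans[OF trans(1,2)] by simp
  next
    case (local x)
    have dist_line: "dist (z + s *\<^sub>R v) (z + t *\<^sub>R v) = norm v * \<bar>s - t\<bar>" for s t
      by (simp add: dist_norm flip: scaleR_diff_left)
    have near: "\<exists>\<delta>>0. \<forall>t. \<bar>t - x\<bar> < \<delta> \<longrightarrow> z + t *\<^sub>R v \<in> ball (z + x *\<^sub>R v) r" if "r > 0" for r
    proof -
      have "open ((\<lambda>t. z + t *\<^sub>R v) -` ball (z + x *\<^sub>R v) r)"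
        by (intro open_vimage continuous_intros open_ball)
      moreover have "x \<in> (\<lambda>t. z + t *\<^sub>R v) -` ball (z + x *\<^sub>R v) r" using that by simp
      ultimately obtain \<delta> where "\<delta> > 0" "ball x \<delta> \<subseteq> (\<lambda>t. z + t *\<^sub>R v) -` ball (z + x *\<^sub>R v) r"
        unfolding open_contains_ball by blast
      then show ?thesis by (auto simp: dist_real_def subset_iff intro!: exI[of _ \<delta>])
    qed
    show ?case
    proof (cases "x \<in> N")
      case False
      then have "locally_reachable T 1 (z + x *\<^sub>R v)"
        using locally_reachable_outside[OF T] by (simp add: N_def)
      then obtain r where r: "r > 0"
        "\<And>p q. p \<in> ball (z + x *\<^sub>R v) r \<Longrightarrow> q \<in> ball (z + x *\<^sub>R v) r \<Longrightarrow> reach T p q (1 * dist p q)"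
        unfolding locally_reachable_def by blast
      obtain \<delta> where \<delta>: "\<delta> > 0" "\<forall>t. \<bar>t - x\<bar> < \<delta> \<longrightarrow> z + t *\<^sub>R v \<in> ball (z + x *\<^sub>R v) r"
        using near[OF r(1)] by blast
      have "reach T (z + a *\<^sub>R v) (z + b *\<^sub>R v) (norm v * (b - a) + D * \<mu> a b)"
        if "a \<le> x \<and> x \<le> b \<and> b - a < \<delta>" for a b
      proof -
        have "reach T (z + a *\<^sub>R v) (z + b *\<^sub>R v) (1 * dist (z + a *\<^sub>R v) (z + b *\<^sub>R v))"
          by (intro r(2) \<delta>(2)[rule_format]) (use that in arith)+
        \<comment> \<open>The segment itself suffices here; the allowance for detours is
          slack.\<close>
        moreover have "0 \<le> D * \<mu> a b" using D0 by (simp add: \<mu>_def)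
        ultimately show ?thesis using that by (auto simp: dist_line elim!: reach_mono)
      qed
      then show ?thesis using \<delta>(1) by blast
    next
      case True
      have "locally_reachable T C (z + x *\<^sub>R v)" using C local by auto
      then obtain r where r: "r > 0"
        "\<And>p q. p \<in> ball (z + x *\<^sub>R v) r \<Longrightarrow> q \<in> ball (z + x *\<^sub>R v) r \<Longrightarrow> reach T p q (C * dist p q)"
        unfolding locally_reachable_def by blast
      obtain \<delta> where \<delta>: "\<delta> > 0" "\<forall>t. \<bar>t - x\<bar> < \<delta> \<longrightarrow> z + t *\<^sub>R v \<in> ball (z + x *\<^sub>R v) r"
        using near[OF r(1)] by blast
      obtain \<delta>' where \<delta>': "\<delta>' > 0" "ball x \<delta>' \<subseteq> W"
        using W(1,2) True unfolding open_contains_ball by blast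
      have "reach T (z + a *\<^sub>R v) (z + b *\<^sub>R v) (norm v * (b - a) + D * \<mu> a b)"
        if ab: "a \<le> x \<and> x \<le> b \<and> b - a < min \<delta> \<delta>'" for a b
      proof -
        \<comment> \<open>A short interval around a point of \<open>N\<close> lies in
          \<open>W\<close>, so the allowance \<open>D * \<mu> a b\<close> equals
          \<open>D * (b - a)\<close> and pays for the whole detour.\<close>
        have "{a..<b} \<subseteq> ball x \<delta>'" using ab by (auto simp: dist_real_def)
        then have "W \<inter> {a..<b} = {a..<b}" using \<delta>'(2) by auto
        then have \<mu>: "\<mu> a b = b - a" using ab by (simp add: \<mu>_def)
        have "reach T (z + a *\<^sub>R v) (z + b *\<^sub>R v) (C * dist (z + a *\<^sub>R v) (z + b *\<^sub>R v))"
          by (intro r(2) \<delta>(2)[rule_format]) (use ab in arith)+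
        moreover have "0 \<le> norm v * (b - a)" using ab by simp
        ultimately show ?thesis using ab by (auto simp: dist_line \<mu> D_def algebra_simps elim!: reach_mono)
      qed
      then show ?thesis using \<delta>(1) \<delta>'(1) by (metis min_less_iff_conj)
    qed
  qed
  moreover have "D * \<mu> 0 1 \<le> e"
  proof -
    have "ennreal (\<mu> 0 1) \<le> emeasure lebesgue W"
      unfolding \<mu>_def using meas[of 0 1] W'
      by (metis emeasure_eq_measure2 emeasure_mono inf_le1)
    then have "\<mu> 0 1 < d" using emW d
      by (metis ennreal_less_iff le_less_trans measure_nonneg \<mu>_def)
    then have "D * \<mu> 0 1 \<le> D * d" using D0 by (intro mult_left_mono) auto
    also have "\<dots> \<le> e" using D0 e by (simp add: d_def field_simps)
    finally show ?thesis .
  qed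
  ultimately show ?thesis by (auto elim!: reach_mono)
qed

section \<open>Almost every translate, and joining arbitrary points\<close>

text \<open>For fixed \<open>t\<close> the \<open>z\<close> with \<open>z + t *\<^sub>R v\<close> in
  \<open>T\<close> form a translate of \<open>T\<close>, a null set; Fubini exchanges the two
  almost-everywhere quantifiers.\<close>

lemma AE_line_negligible:
  fixes T :: "'a::euclidean_space set"
  assumes T: "closed T" and null: "negligible T"
  shows "AE z in lborel. negligible {t. z + t *\<^sub>R v \<in> T}"
proof -
  \<comment> \<open>Closedness of \<open>T\<close> makes the set of bad pairs Borel, as the exchange
    requires.\<close>
  have "closed ((\<lambda>x::'a \<times> real. fst x + snd x *\<^sub>R v) -` T)"
    by (intro closed_vimage T continuous_intros)
  then have "(\<lambda>x::'a \<times> real. fst x + snd x *\<^sub>R v) -` (- T) \<in> sets borel"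
    by (metis borel_closed borel_comp vimage_Compl)
  then have "{x \<in> space (lborel \<Otimes>\<^sub>M lborel). fst x + snd x *\<^sub>R v \<notin> T} \<in> sets (lborel \<Otimes>\<^sub>M lborel)"
    unfolding lborel_prod by (simp add: vimage_def)
  then have comm: "(AE z in lborel. AE t in lborel. z + t *\<^sub>R v \<notin> T) \<longleftrightarrow>
      (AE t in lborel. AE z in lborel. z + t *\<^sub>R v \<notin> T)"
    by (rule lborel_pair.AE_commute)
  have TN: "T \<in> null_sets lborel"
    using T null by (simp add: negligible_iff_null_sets null_sets_completion_iff)
  have "AE z in lborel. z + t *\<^sub>R v \<notin> T" for t
    using null_sets_translation[OF TN, of "- (t *\<^sub>R v)"] by (intro AE_I') auto
  then have "AE z in lborel. AE t in lborel. z + t *\<^sub>R v \<notin> T"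
    unfolding comm by simp
  then show ?thesis
  proof eventually_elim
    case (elim z)
    have "closed ((\<lambda>t. z + t *\<^sub>R v) -` T)"
      by (intro closed_vimage T continuous_intros)
    then have "{t. z + t *\<^sub>R v \<in> T} \<in> sets lborel" by (simp add: vimage_def)
    then have "{t. z + t *\<^sub>R v \<in> T} \<in> null_sets lborel"
      using elim by (simp add: AE_iff_null_sets)
    then show ?case
      by (simp add: negligible_iff_null_sets null_sets_completionI)
  qed
qed

text \<open>The path goes from \<open>x\<close> to a nearby \<open>z\<close>, along the translated
  segment to \<open>z + v\<close>, and from there to \<open>y\<close>; each piece may add
  \<open>e / 3\<close>.\<close>

lemma reach_dist_plus:
  fixes T :: "'a::euclidean_space set"
  assumes T: "closed T" "negligible T" and loc: "\<And>\<xi>. \<exists>C. locally_reachable T C \<xi>" and e: "e > 0"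
  shows "reach T x y (dist x y + e)"
proof -
  obtain C1 C2 where "locally_reachable T C1 x" "locally_reachable T C2 y" using loc by meson
  define C where "C = max 0 (max C1 C2)"
  have "locally_reachable T C x" "locally_reachable T C y" and C0: "C \<ge> 0"
    using \<open>locally_reachable T C1 x\<close> \<open>locally_reachable T C2 y\<close>
    by (auto simp: C_def elim!: locally_reachable_mono)
  then obtain r1 r2 where r1: "r1 > 0" "\<And>p q. p \<in> ball x r1 \<Longrightarrow> q \<in> ball x r1 \<Longrightarrow> reach T p q (C * dist p q)"
    and r2: "r2 > 0" "\<And>p q. p \<in> ball y r2 \<Longrightarrow> q \<in> ball y r2 \<Longrightarrow> reach T p q (C * dist p q)"
    unfolding locally_reachable_def by blast
  \<comment> \<open>Small enough for both balls and for \<open>C * \<delta> \<le> e / 3\<close>; the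
    summand 1 covers \<open>C = 0\<close>.\<close>
  define \<delta> where "\<delta> = min (min r1 r2) (e / (3 * (C + 1)))"
  have \<delta>: "\<delta> > 0" "\<delta> \<le> r1" "\<delta> \<le> r2" "\<delta> \<le> e / (3 * (C + 1))"
    using r1(1) r2(1) e C0 by (auto simp: \<delta>_def)
  have C\<delta>: "C * \<delta> \<le> e / 3"
  proof -
    have "C * \<delta> \<le> C * (e / (3 * (C + 1)))" using \<delta>(4) C0 by (intro mult_left_mono) auto
    also have "\<dots> \<le> e / 3" using C0 e by (simp add: field_simps)
    finally show ?thesis .
  qed
  define v where "v = y - x"
  obtain N where N: "N \<in> null_sets lborel" "{z. \<not> negligible {t. z + t *\<^sub>R v \<in> T}} \<subseteq> N"
    using AE_line_negligible[OF T, of v] by (auto elim!: AE_E simp: null_sets_def)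
  have "negligible N" using N(1) by (simp add: negligible_iff_null_sets null_sets_completionI)
  \<comment> \<open>The exceptional translates form a null set, so every ball around
    \<open>x\<close> contains a good \<open>z\<close>.\<close>
  then have "\<not> ball x \<delta> \<subseteq> N"
    using \<delta>(1) open_not_negligible[of "ball x \<delta>"] negligible_subset by auto
  then obtain z where z: "z \<in> ball x \<delta>" "negligible {t. z + t *\<^sub>R v \<in> T}"
    using N(2) by blast
  have dz: "dist (z + v) y = dist x z" "dist x z < \<delta>"
    using z(1) by (auto simp: v_def dist_norm norm_minus_commute)
  have "reach T x z (C * dist x z)" using z \<delta> by (intro r1(2)) auto
  moreover have "reach T z (z + v) (norm v + e / 3)"
    using e by (intro reach_along_null_segment T loc z) auto
  moreover have "reach T (z + v) y (C * dist (z + v) y)"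
    using dz \<delta> by (intro r2(2)) (auto simp: dist_commute)
  ultimately have "reach T x y (C * dist x z + (norm v + e / 3) + C * dist (z + v) y)"
    using reach_trans by blast
  moreover have "C * dist x z \<le> C * \<delta>" using dz C0 by (intro mult_left_mono) auto
  ultimately show ?thesis
    using C\<delta> dz by (auto simp: v_def dist_norm norm_minus_commute elim!: reach_mono)
qed

section \<open>Comparison of the path distances\<close>

text \<open>The stronger condition admits fewer paths, so its infimum is larger or equal.\<close>

lemma restricted_path_dist_antimono:
  assumes "\<And>S. P S \<Longrightarrow> Q S"
  shows "restricted_path_dist Q x y \<le> restricted_path_dist P x y"
  unfolding restricted_path_dist_def using assms by (intro Inf_superset_mono) blast

lemma dist_le_path_dist: "ennreal (dist x y) \<le> path_dist x y"
  unfolding path_dist_def restricted_path_dist_def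
  using path_length_ge_dist by (fastforce simp: path_from_to_def intro!: Inf_greatest)

theorem theorem31:
  fixes \<Theta> :: "(real ^ 'n::{finite,linorder}) set" and m :: nat
  assumes "lipschitz_submanifold m \<Theta>" and "closed \<Theta>"
  shows "(\<forall>x y (\<epsilon> :: real). \<epsilon> > 0 \<longrightarrow>
            (\<exists>\<gamma> a b. path_from_to \<gamma> a b x y \<and>
               path_length \<gamma> a b < ennreal (norm (x - y) + \<epsilon>) \<and>
               finite (\<gamma> ` {a..b} \<inter> \<Theta>)))
         \<and> finitely_permeable \<Theta> \<and> permeable \<Theta>"
proof -
  have loc: "\<exists>C. locally_reachable \<Theta> C \<xi>" for \<xi>
    using locally_reachable_submanifold[OF assms(1)] locally_reachable_outside[OF assms(2)] by blast
  have paths: "\<exists>\<gamma> a b. path_from_to \<gamma> a b x y \<and> path_length \<gamma> a b < ennreal (norm (x - y) + \<epsilon>) \<and>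
      finite (\<gamma> ` {a..b} \<inter> \<Theta>)" if "\<epsilon> > 0" for x y and \<epsilon> :: real
  proof -
    have "reach \<Theta> x y (dist x y + \<epsilon> / 2)"
      using that
      by (intro reach_dist_plus[OF assms(2) negligible_lipschitz_submanifold[OF assms(1)] loc]) auto
    then obtain \<gamma> a b where "path_from_to \<gamma> a b x y" "path_length \<gamma> a b < ennreal (norm (x - y) + \<epsilon>)"
        "finite (\<gamma> ` {a..b} \<inter> \<Theta>)"
      by (rule reach_imp_path[where k = "norm (x - y) + \<epsilon>"]) (use \<open>\<epsilon> > 0\<close> in \<open>simp add: dist_norm\<close>)
    then show ?thesis by blast
  qed
  \<comment> \<open>The chord bounds \<open>path_dist\<close> from below, and admissible paths
    exceed it by less than any given \<open>\<epsilon>\<close>.\<close>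
  have fin: "path_dist_finite \<Theta> x y \<le> path_dist x y" for x y
  proof (rule order_trans[OF _ dist_le_path_dist], rule ennreal_le_epsilon)
    fix \<epsilon> :: real assume "\<epsilon> > 0"
    then obtain \<gamma> a b where \<gamma>: "path_from_to \<gamma> a b x y"
      "path_length \<gamma> a b < ennreal (norm (x - y) + \<epsilon>)" "finite (\<gamma> ` {a..b} \<inter> \<Theta>)"
      using paths by blast
    then have "path_length \<gamma> a b < \<infinity>"
      by (metis ennreal_less_top infinity_ennreal_def less_trans)
    then have "path_dist_finite \<Theta> x y \<le> path_length \<gamma> a b"
      unfolding path_dist_finite_def restricted_path_dist_def using \<gamma> by (intro Inf_lower) blast
    then show "path_dist_finite \<Theta> x y \<le> ennreal (dist x y) + ennreal \<epsilon>"
      using \<gamma>(2) \<open>\<epsilon> > 0\<close> by (simp add: dist_norm ennreal_plus[symmetric] del: ennreal_plus)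
  qed
  \<comment> \<open>These two inequalities and \<open>fin\<close> form a cycle, so all three
    distances agree. A finite set is its own closure, hence the second one.\<close>
  have "path_dist x y \<le> path_dist_countable \<Theta> x y" for x y
    unfolding path_dist_def path_dist_countable_def by (intro restricted_path_dist_antimono) simp
  moreover have "path_dist_countable \<Theta> x y \<le> path_dist_finite \<Theta> x y" for x y
    unfolding path_dist_finite_def path_dist_countable_def
    by (intro restricted_path_dist_antimono)
       (simp add: finite_imp_closed closure_closed countable_finite)
  ultimately have "path_dist = path_dist_finite \<Theta>" "path_dist = path_dist_countable \<Theta>"
    using fin by (meson antisym ext order_trans)+
  then show ?thesis
    unfolding finitely_permeable_def permeable_def using paths by blast
qed

end
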